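(* Let $\lambda>0$ and $r>0$ be fixed. As $n\to\infty$, the number of connected components of the exponential random geometric graph $G_n(\lambda,r)$ converges in distribution, i.e. the probability mass function of the number of components converges as $n\to\infty$.
   Context: $G_n(\lambda,r)$ is the random graph with vertex set $\{X_1,\dots,X_n\}$, where $X_1,\dots,X_n$ are i.i.d. exponential random variables with mean $\lambda^{-1}$, and with an edge between $X_i$ and $X_j$ ($i\neq j$) if and only if $|X_i-X_j|\le r$. *)

theory Defs
  imports "HOL-Probability.Probability" "Graph_Theory.Graph_Theory"
begin

text \<open>
  Undirected simple graphs are rendered, as usual in \<^theory>\<open>Graph_Theory.Graph_Theory\<close>, as loop-free
  symmetric digraphs: an edge between \<open>i\<close> and \<open>j\<close> is the pair of arcs \<open>(i, j)\<close>, \<open>(j, i)\<close>.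
  The vertices are the labels \<open>1, \<dots>, n\<close> of the points rather than the points themselves, so that
  the graph has \<open>n\<close> vertices also on the null event that two points coincide.
\<close>

definition geometric_graph :: "nat \<Rightarrow> real \<Rightarrow> (nat \<Rightarrow> real) \<Rightarrow> nat pair_pre_digraph" where
  "geometric_graph n r x =
     \<lparr> pverts = {1..n},
       parcs = {(i, j). i \<in> {1..n} \<and> j \<in> {1..n} \<and> i \<noteq> j \<and> \<bar>x i - x j\<bar> \<le> r} \<rparr>"

lemma pair_graph_geometric_graph: "pair_graph (geometric_graph n r x)"
proof -
  have "finite (parcs (geometric_graph n r x))"
    by (rule finite_subset[of _ "{1..n} \<times> {1..n}"]) (auto simp: geometric_graph_def)
  then show ?thesis
    by unfold_locales
      (auto simp: geometric_graph_def symmetric_def sym_def abs_minus_commute)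
qed

text \<open>
  A connected component is a maximal connected subgraph. The name \<open>connected\<close> is qualified because
  it also denotes topological connectedness.
\<close>

definition connected_components :: "('a, 'b) pre_digraph \<Rightarrow> ('a, 'b) pre_digraph set" where
  "connected_components G = {H. pre_digraph.max_subgraph G Digraph_Component.connected H}"

definition num_components :: "('a, 'b) pre_digraph \<Rightarrow> nat" where
  "num_components G = card (connected_components G)"

end

theory Submission
  imports Defs
begin

text \<open>
  Read from left to right, the points of the graph fall into clusters, and a new cluster starts
  exactly where two consecutive points are more than \<open>r\<close> apart. So the number of components is the
  number of points that have no point to their right within distance \<open>r\<close>
  (\<open>num_components_geometric_graph\<close>). This turns a question about graphs into one about spacings.

  The spacings are handled one at a time, from the left. The exponential distribution is
  memoryless: given that \<open>x i\<close> is the minimum of \<open>n + 1\<close> independent exponential variables, the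
  distances from \<open>x i\<close> to the other points are again \<open>n\<close> independent exponential variables
  (\<open>nn_integral_beyond_minimum\<close>). Removing the minimum removes one cluster if all those
  distances exceed \<open>r\<close>, which has probability \<open>q ^ n\<close> with \<open>q = exp (- rate * r)\<close>, and changes
  nothing in the number of clusters otherwise. Moreover, if all the distances exceed \<open>r\<close>, they can
  be shortened by \<open>r\<close>, which leaves the clusters beyond the minimum as they are and, by
  memorylessness again, the law as well: the first gap is independent of the number of clusters
  behind it. Hence the law of the number of clusters satisfies the recursion
  \<open>a (n + 1) k = (1 - q ^ n) * a n k + q ^ n * a n (k - 1)\<close>, in which each step adds an independent
  Bernoulli variable of parameter \<open>q ^ n\<close> (\<open>nn_integral_indicator_num_clusters\<close>).

  The parameters \<open>q ^ n\<close> are summable, so the sum of these variables is finite almost surely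
  and its law is the limit. In terms of the recursion: the distribution functions
  \<open>\<Sum>k\<le>K. a n k\<close> decrease in \<open>n\<close> and hence converge, and no mass is lost because they stay above
  \<open>1 - q ^ K / (1 - q)\<close> (\<open>cluster_pmf_tendsto\<close>). For variables with values in the naturals,
  convergence of the probability mass functions gives weak convergence, as a distribution function
  is a finite sum of point masses (\<open>weak_conv_m_of_pmf_tendsto\<close>).
\<close>

section \<open>Components of symmetric digraphs\<close>

lemma strongly_connected_imp_connected:
  assumes "wf_digraph G" "strongly_connected G"
  shows "Digraph_Component.connected G"
  using assms unfolding Digraph_Component.connected_def strongly_connected_def
  by (auto intro: wf_digraph.reachable_mk_symmetricI)

lemma (in sym_digraph) connected_subgraph_subset_scc_of:
  assumes "subgraph H G" "Digraph_Component.connected H" "v \<in> verts H"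
  shows "verts H \<subseteq> scc_of v"
proof
  fix u assume "u \<in> verts H"
  then have "u \<rightarrow>\<^sup>*\<^bsub>mk_symmetric H\<^esub> v"
    using assms unfolding Digraph_Component.connected_def strongly_connected_def by auto
  then have "u \<rightarrow>\<^sup>*\<^bsub>mk_symmetric G\<^esub> v"
    by (rule pre_digraph.reachable_mono) (rule subgraph_mk_symmetric[OF assms(1)])
  then have "u \<rightarrow>\<^sup>* v"
    by (simp only: reachable_mk_symmetric_eq[OF sym_arcs])
  then show "u \<in> scc_of v"
    by (rule scc_ofI_reachable)
qed

text \<open>
  The components are maximal among all connected subgraphs, the strong components among
  strongly connected ones, and a connected subgraph of a symmetric digraph need not be symmetric
  itself. Both families nevertheless consist of the subgraphs induced by the reachability classes,
  as a connected subgraph lies inside the class of each of its vertices.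
\<close>

lemma (in sym_digraph) connected_components_eq_sccs: "connected_components G = sccs"
proof -
  have sub: "subgraph H (G \<restriction> scc_of v)"
    if "subgraph H G" "Digraph_Component.connected H" "v \<in> verts H" for H v
  proof (rule subgraphI)
    have S: "verts H \<subseteq> scc_of v" by (rule connected_subgraph_subset_scc_of[OF that])
    then show "verts H \<subseteq> verts (G \<restriction> scc_of v)" by simp
    have H: "wf_digraph H" "arcs H \<subseteq> arcs G" "compatible G H" using that(1) by auto
    show "arcs H \<subseteq> arcs (G \<restriction> scc_of v)"
    proof
      fix e assume e: "e \<in> arcs H"
      then have "tail H e \<in> verts H" "head H e \<in> verts H"
        using H(1) by (auto simp: wf_digraph_def)
      then show "e \<in> arcs (G \<restriction> scc_of v)"
        using e S H by (auto simp: compatible_def)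
    qed
    show "compatible (G \<restriction> scc_of v) H" using H(3) by (simp add: compatible_def)
    show "wf_digraph H" by fact
    show "wf_digraph (G \<restriction> scc_of v)" by (rule wellformed_induce_subgraph)
  qed
  have scc: "G \<restriction> scc_of v \<in> sccs" if "v \<in> verts G" for v
    using that scc_of_in_sccs_verts in_sccs_verts_conv by blast
  show ?thesis
  proof (intro set_eqI iffI)
    fix H assume "H \<in> connected_components G"
    then have H: "max_subgraph Digraph_Component.connected H"
      by (simp add: connected_components_def)
    then have HG: "subgraph H G" "Digraph_Component.connected H"
      by (auto simp: max_subgraph_def)
    then obtain v where v: "v \<in> verts H"
      unfolding Digraph_Component.connected_def strongly_connected_def by auto
    with HG have vG: "v \<in> verts G" by auto
    have C: "subgraph (G \<restriction> scc_of v) G" "Digraph_Component.connected (G \<restriction> scc_of v)"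
      using scc[OF vG] by (auto simp: sccs_def intro: strongly_connected_imp_connected)
    have "H = G \<restriction> scc_of v"
      using H sub[OF HG v] C unfolding max_subgraph_def by metis
    then show "H \<in> sccs" using scc[OF vG] by simp
  next
    fix H assume "H \<in> sccs"
    then have H: "max_subgraph strongly_connected H"
      by (simp add: sccs_altdef2)
    then have HG: "subgraph H G" "strongly_connected H"
      by (auto simp: max_subgraph_def)
    have "max_subgraph Digraph_Component.connected H"
    proof (rule max_subgraphI)
      show "Digraph_Component.connected H" using HG by (auto intro: strongly_connected_imp_connected)
      show "subgraph H G" by fact
    next
      fix K assume K: "H \<noteq> K" "subgraph H K" "subgraph K G"
      show "\<not> Digraph_Component.connected K"
      proof
        assume conn: "Digraph_Component.connected K"
        obtain v where v: "v \<in> verts H" using HG by (auto simp: strongly_connected_def)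
        then have vK: "v \<in> verts K" using K(2) by auto
        then have vG: "v \<in> verts G" using K(3) by auto
        have KC: "subgraph K (G \<restriction> scc_of v)" by (rule sub[OF K(3) conn vK])
        have "subgraph H (G \<restriction> scc_of v)" using subgraph_trans[OF K(2) KC] .
        then have "H = G \<restriction> scc_of v"
          using H scc[OF vG] unfolding max_subgraph_def sccs_def by (metis (no_types, lifting) induced_imp_subgraph mem_Collect_eq)
        then have "H = K"
          using K(2) KC by (auto simp: subgraph_def compatible_def intro!: pre_digraph.equality)
        with K(1) show False ..
      qed
    qed
    then show "H \<in> connected_components G" by (simp add: connected_components_def)
  qed
qed

section \<open>Components of a geometric graph on the line\<close>

text \<open>
  The points are ordered by position first and label second. This breaks ties, so that the number of
  components below is correct for every configuration, also when points coincide.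
\<close>

definition gap_after :: "real \<Rightarrow> nat set \<Rightarrow> (nat \<Rightarrow> real) \<Rightarrow> nat \<Rightarrow> bool" where
  "gap_after r I x i \<longleftrightarrow> (\<forall>j\<in>I. x i < x j \<or> x i = x j \<and> i < j \<longrightarrow> x i + r < x j)"

definition num_clusters :: "real \<Rightarrow> nat set \<Rightarrow> (nat \<Rightarrow> real) \<Rightarrow> nat" where
  "num_clusters r I x = card {i\<in>I. gap_after r I x i}"

text \<open>
  Each component contains exactly one point with a gap after it, namely its last point in the order
  by position and label: no path leads from such a point to a later one, since one of its steps
  would have to jump over the gap.
\<close>

lemma num_components_geometric_graph:
  assumes r: "r > 0"
  shows "num_components (with_proj (geometric_graph n r x)) = num_clusters r {1..n} x"
proof -
  let ?G = "geometric_graph n r x"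
  interpret pair_graph ?G by (rule pair_graph_geometric_graph)
  let ?L = "{i\<in>{1..n}. gap_after r {1..n} x i}"
  have V: "pverts ?G = {1..n}" by (simp add: geometric_graph_def)
  define before where "before i j \<longleftrightarrow> x i < x j \<or> x i = x j \<and> i < j" for i j
  have arc: "(i, j) \<in> parcs ?G \<longleftrightarrow> i \<in> {1..n} \<and> j \<in> {1..n} \<and> i \<noteq> j \<and> \<bar>x i - x j\<bar> \<le> r" for i j
    by (simp add: geometric_graph_def)
  \<comment> \<open>A walk that starts at \<open>i\<close> never gets past \<open>i\<close>: its first step to do so would have to bridge the gap.\<close>
  have top: "\<not> before i j" if i: "i \<in> ?L" and ij: "i \<rightarrow>\<^sup>*\<^bsub>?G\<^esub> j" for i j
    using ij
  proof (induction rule: reachable_induct)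
    case base show ?case by (simp add: before_def)
  next
    case (step a b)
    then have ab: "a \<in> {1..n}" "b \<in> {1..n}" "\<bar>x a - x b\<bar> \<le> r"
      by (simp_all add: arc)
    show ?case
    proof
      assume bef: "before i b"
      then have "x i + r < x b" using i ab by (auto simp: gap_after_def before_def)
      moreover have "x a \<le> x i" using step.IH by (auto simp: before_def)
      ultimately show False using ab(3) by linarith
    qed
  qed
  have inj: "inj_on scc_of ?L"
  proof (rule inj_onI)
    fix i j assume ij: "i \<in> ?L" "j \<in> ?L" "scc_of i = scc_of j"
    then have "j \<in> scc_of i" using in_scc_of_self[of j] V by simp
    then have "i \<rightarrow>\<^sup>*\<^bsub>?G\<^esub> j" "j \<rightarrow>\<^sup>*\<^bsub>?G\<^esub> i" by (auto simp: scc_of_def)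
    then have "\<not> before i j" "\<not> before j i" using top ij by blast+
    then show "i = j" by (auto simp: before_def)
  qed
  have surj: "scc_of v \<in> scc_of ` ?L" if v: "v \<in> {1..n}" for v
  proof -
    have sub: "scc_of v \<subseteq> {1..n}"
      using scc_of_in_sccs_verts[of v] sccs_verts_subsets v V by blast
    then have fin: "finite (scc_of v)" by (rule finite_subset) simp
    have ne: "v \<in> scc_of v" using in_scc_of_self V v by simp
    \<comment> \<open>The last point of the component: the greatest label among the points of greatest position.\<close>
    define m where "m = Max (x ` scc_of v)"
    define T where "T = {j\<in>scc_of v. x j = m}"
    have "m \<in> x ` scc_of v" unfolding m_def using fin ne by (intro Max_in) auto
    then have T: "finite T" "T \<noteq> {}" using fin by (auto simp: T_def)
    define i where "i = Max T"
    have "i \<in> T" unfolding i_def using T by (rule Max_in)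
    then have i: "i \<in> scc_of v" "x i = m" by (auto simp: T_def)
    have le: "x j \<le> x i" if "j \<in> scc_of v" for j
      using that fin unfolding i(2) m_def by simp
    have iV: "i \<in> {1..n}" using i sub by auto
    have "gap_after r {1..n} x i"
      unfolding gap_after_def
    proof (intro ballI impI)
      fix j assume j: "j \<in> {1..n}" "x i < x j \<or> x i = x j \<and> i < j"
      show "x i + r < x j"
      proof (rule ccontr)
        assume "\<not> x i + r < x j"
        then have "(i, j) \<in> parcs ?G" using j iV by (auto simp: arc)
        then have "j \<in> scc_of i" by (intro scc_ofI_reachable') auto
        then have js: "j \<in> scc_of v" using scc_of_eq[OF i(1)] by simp
        then have "x j = m" using le[OF js] j(2) i(2) by auto
        then have "j \<le> i" using js T(1) unfolding i_def by (auto simp: T_def)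
        then show False using \<open>x j = m\<close> i(2) j(2) by auto
      qed
    qed
    then have "i \<in> ?L" using iV by simp
    then show ?thesis using scc_of_eq[OF i(1)] by auto
  qed
  have "connected_components (with_proj ?G) = sccs"
    by (rule sym_digraph.connected_components_eq_sccs) unfold_locales
  then have "num_components (with_proj ?G) = card sccs_verts"
    unfolding num_components_def by (simp add: card_sccs_verts)
  also have "sccs_verts = scc_of ` ?L"
    unfolding sccs_verts_conv_scc_of V using surj by auto
  also have "card \<dots> = card ?L" by (rule card_image[OF inj])
  finally show ?thesis by (simp add: num_clusters_def)
qed

lemma gap_after_translate:
  assumes "\<And>j. j \<in> I \<Longrightarrow> x j = y j + c" "i \<in> I"
  shows "gap_after r I x i \<longleftrightarrow> gap_after r I y i"
  using assms by (auto simp: gap_after_def algebra_simps)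

lemma num_clusters_translate:
  assumes "\<And>j. j \<in> I \<Longrightarrow> x j = y j + c"
  shows "num_clusters r I x = num_clusters r I y"
  unfolding num_clusters_def using gap_after_translate[of I x y c, OF assms]
  by (metis (mono_tags, lifting))

text \<open>
  A new leftmost point is not to the right of any old point, so it does not affect their gaps.
\<close>

lemma num_clusters_insert_minimum:
  assumes "finite J" "i \<notin> J" and min: "\<And>j. j \<in> J \<Longrightarrow> x i < x j"
  shows "num_clusters r (insert i J) x =
    num_clusters r J x + of_bool (\<forall>j\<in>J. x i + r < x j)"
proof -
  have "gap_after r (insert i J) x l \<longleftrightarrow> gap_after r J x l" if "l \<in> J" for l
    using min[OF that] by (auto simp: gap_after_def)
  moreover have "gap_after r (insert i J) x i \<longleftrightarrow> (\<forall>j\<in>J. x i + r < x j)"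
    using min by (auto simp: gap_after_def)
  ultimately have "{l \<in> insert i J. gap_after r (insert i J) x l} =
      (if \<forall>j\<in>J. x i + r < x j then insert i {l \<in> J. gap_after r J x l} else {l \<in> J. gap_after r J x l})"
    by auto
  then show ?thesis using assms by (simp add: num_clusters_def)
qed

lemma measurable_num_clusters:
  assumes I: "finite I"
  shows "num_clusters r I \<in> measurable (PiM I (\<lambda>_. borel)) (count_space UNIV)"
proof -
  have "Measurable.pred (PiM I (\<lambda>_. borel)) (\<lambda>x. i \<in> {i\<in>I. gap_after r I x i})" for i
  proof (cases "i \<in> I")
    case True
    have "Measurable.pred (PiM I (\<lambda>_. borel)) (\<lambda>x. x i < x j \<or> x i = x j \<and> i < j \<longrightarrow> x i + r < x j)"
      if j: "j \<in> I" for j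
    proof -
      have [measurable]: "(\<lambda>x. x i) \<in> borel_measurable (PiM I (\<lambda>_. borel :: real measure))"
        "(\<lambda>x. x j) \<in> borel_measurable (PiM I (\<lambda>_. borel :: real measure))"
        using True j by simp_all
      have eq: "x i = x j \<longleftrightarrow> \<not> x i < x j \<and> \<not> x j < x i" for x :: "nat \<Rightarrow> real"
        by auto
      show ?thesis
        unfolding eq
        by (intro pred_intros_logic borel_measurable_pred_less borel_measurable_add borel_measurable_const) fact+
    qed
    then show ?thesis using True I by (simp add: gap_after_def pred_intros_finite)
  qed simp
  then show ?thesis unfolding num_clusters_def
    by (intro measurable_card) (simp_all add: Measurable.pred_def)
qed

lemma borel_measurable_num_clusters:
  fixes \<phi> :: "nat \<Rightarrow> ennreal"
  assumes "finite I"
  shows "(\<lambda>x. \<phi> (num_clusters r I x)) \<in> borel_measurable (PiM I (\<lambda>_. borel))"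
  by (rule measurable_compose[OF measurable_num_clusters[OF assms], of \<phi>]) simp

section \<open>Independent exponential variables beyond their minimum\<close>

definition exponential_measure :: "real \<Rightarrow> real measure" where
  "exponential_measure l = density lborel (exponential_density l)"

lemma sets_exponential_measure [simp, measurable_cong]: "sets (exponential_measure l) = sets borel"
  by (simp add: exponential_measure_def)

lemma space_exponential_measure [simp]: "space (exponential_measure l) = UNIV"
  by (simp add: exponential_measure_def)

lemma prob_space_exponential_measure: "0 < l \<Longrightarrow> prob_space (exponential_measure l)"
  by (simp add: exponential_measure_def prob_space_exponential_density)

lemma product_prob_space_exponential:
  "0 < l \<Longrightarrow> product_prob_space (\<lambda>_. exponential_measure l)"
  by (intro product_prob_spaceI prob_space_exponential_measure)

lemma AE_exponential_measure_nonneg: "AE y in exponential_measure l. 0 \<le> y"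
  unfolding exponential_measure_def
  by (subst AE_density) (auto simp: exponential_density_def)

text \<open>
  Memorylessness of a single exponential variable: on the event that it exceeds \<open>c\<close>, its excess over
  \<open>c\<close> is distributed as the variable itself.
\<close>

lemma nn_integral_exponential_shift:
  assumes c: "0 \<le> c" and l: "0 < l" and [measurable]: "g \<in> borel_measurable borel"
  shows "(\<integral>\<^sup>+y. (if c < y then g (y - c) else 0) \<partial>exponential_measure l) =
    ennreal (exp (- l * c)) * (\<integral>\<^sup>+y. g y \<partial>exponential_measure l)"
proof -
  have "(\<integral>\<^sup>+y. (if c < y then g (y - c) else 0) \<partial>exponential_measure l) =
      (\<integral>\<^sup>+y. ennreal (exponential_density l y) * (if c < y then g (y - c) else 0) \<partial>lborel)"
    unfolding exponential_measure_def by (subst nn_integral_density) auto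
  also have "\<dots> = (\<integral>\<^sup>+y. ennreal (exponential_density l (c + y)) * (if 0 < y then g y else 0) \<partial>lborel)"
    by (subst nn_integral_real_affine[where c = 1 and t = c]) (auto intro!: nn_integral_cong)
  also have "\<dots> = (\<integral>\<^sup>+y. ennreal (exp (- l * c)) * (ennreal (exponential_density l y) * g y) \<partial>lborel)"
  proof (rule nn_integral_cong_AE)
    show "AE y in lborel. ennreal (exponential_density l (c + y)) * (if 0 < y then g y else 0) =
        ennreal (exp (- l * c)) * (ennreal (exponential_density l y) * g y)"
      using AE_lborel_singleton[of 0]
    proof eventually_elim
      fix y :: real assume "y \<noteq> 0"
      show "ennreal (exponential_density l (c + y)) * (if 0 < y then g y else 0) =
          ennreal (exp (- l * c)) * (ennreal (exponential_density l y) * g y)"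
      proof (cases "0 < y")
        case True
        then have "exponential_density l (c + y) = exp (- l * c) * exponential_density l y"
          using c by (simp add: exponential_density_def exp_add [symmetric] algebra_simps)
        then show ?thesis
          using True l by (simp add: ennreal_mult exponential_density_nonneg mult.assoc)
      next
        case False
        then show ?thesis using \<open>y \<noteq> 0\<close> by (simp add: exponential_density_def)
      qed
    qed
  qed
  also have "\<dots> = ennreal (exp (- l * c)) * (\<integral>\<^sup>+y. ennreal (exponential_density l y) * g y \<partial>lborel)"
    by (rule nn_integral_cmult) simp
  also have "(\<integral>\<^sup>+y. ennreal (exponential_density l y) * g y \<partial>lborel) = (\<integral>\<^sup>+y. g y \<partial>exponential_measure l)"
    unfolding exponential_measure_def by (subst nn_integral_density) auto
  finally show ?thesis .
qed

text \<open>
  Memorylessness of an independent family, one coordinate at a time.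
\<close>

lemma nn_integral_PiM_exponential_shift:
  fixes f :: "('i \<Rightarrow> real) \<Rightarrow> ennreal"
  assumes c: "0 \<le> c" and l: "0 < l" and "finite J"
    and "f \<in> borel_measurable (PiM J (\<lambda>_. borel))"
  shows "(\<integral>\<^sup>+x. (if \<forall>j\<in>J. c < x j then f (\<lambda>j\<in>J. x j - c) else 0) \<partial>PiM J (\<lambda>_. exponential_measure l)) =
    ennreal (exp (- l * c)) ^ card J * (\<integral>\<^sup>+x. f x \<partial>PiM J (\<lambda>_. exponential_measure l))"
  using assms(3,4)
proof (induction J arbitrary: f rule: finite_induct)
  case empty
  show ?case by (simp add: PiM_empty nn_integral_count_space_finite restrict_def)
next
  case (insert j J)
  interpret product_prob_space "\<lambda>_ :: 'i. exponential_measure l"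
    using l by (rule product_prob_space_exponential)
  let ?E = "exponential_measure l"
  let ?q = "ennreal (exp (- l * c))"
  note [measurable] = insert.prems
  note [simp] = \<open>finite J\<close>
  define h where "h x = (\<integral>\<^sup>+y. f (x(j := y)) \<partial>?E)" for x
  have [measurable]: "h \<in> borel_measurable (PiM J (\<lambda>_. borel))"
    unfolding h_def by measurable
  have "(\<integral>\<^sup>+x. (if \<forall>k\<in>insert j J. c < x k then f (\<lambda>k\<in>insert j J. x k - c) else 0) \<partial>PiM (insert j J) (\<lambda>_. ?E)) =
      (\<integral>\<^sup>+x. (\<integral>\<^sup>+y. (if \<forall>k\<in>insert j J. c < (x(j := y)) k then f (\<lambda>k\<in>insert j J. (x(j := y)) k - c) else 0) \<partial>?E) \<partial>PiM J (\<lambda>_. ?E))"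
    using insert.hyps by (intro product_nn_integral_insert) auto
  also have "\<dots> = (\<integral>\<^sup>+x. (if \<forall>k\<in>J. c < x k then ?q * h (\<lambda>k\<in>J. x k - c) else 0) \<partial>PiM J (\<lambda>_. ?E))"
  proof (rule nn_integral_cong)
    fix x assume "x \<in> space (PiM J (\<lambda>_. ?E))"
    have x': "(\<lambda>k\<in>J. x k - c) \<in> space (PiM J (\<lambda>_. borel))" by (simp add: space_PiM)
    have upd: "(\<lambda>k\<in>insert j J. (x(j := y)) k - c) = (\<lambda>k\<in>J. x k - c)(j := y - c)" for y
      using insert.hyps by (auto simp: fun_eq_iff)
    have all: "(\<forall>k\<in>insert j J. c < (x(j := y)) k) \<longleftrightarrow> c < y \<and> (\<forall>k\<in>J. c < x k)" for y
      using insert.hyps by auto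
    have "(\<lambda>y. f ((\<lambda>k\<in>J. x k - c)(j := y))) \<in> borel_measurable borel"
      using x' by measurable
    note shift = nn_integral_exponential_shift[OF c l this]
    define P where "P \<longleftrightarrow> (\<forall>k\<in>J. c < x k)"
    from shift show "(\<integral>\<^sup>+y. (if \<forall>k\<in>insert j J. c < (x(j := y)) k then f (\<lambda>k\<in>insert j J. (x(j := y)) k - c) else 0) \<partial>?E) =
        (if \<forall>k\<in>J. c < x k then ?q * h (\<lambda>k\<in>J. x k - c) else 0)"
      unfolding upd all h_def P_def [symmetric] by (cases P) simp_all
  qed
  also have "\<dots> = ?q ^ card J * (\<integral>\<^sup>+x. ?q * h x \<partial>PiM J (\<lambda>_. ?E))"
    by (rule insert.IH) measurable
  also have "(\<integral>\<^sup>+x. ?q * h x \<partial>PiM J (\<lambda>_. ?E)) = ?q * (\<integral>\<^sup>+x. h x \<partial>PiM J (\<lambda>_. ?E))"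
    by (rule nn_integral_cmult) measurable
  also have "(\<integral>\<^sup>+x. h x \<partial>PiM J (\<lambda>_. ?E)) = (\<integral>\<^sup>+x. f x \<partial>PiM (insert j J) (\<lambda>_. ?E))"
    unfolding h_def using insert.hyps by (intro product_nn_integral_insert [symmetric]) auto
  finally show ?case
    using insert.hyps by (simp add: mult_ac)
qed

text \<open>
  For \<open>y \<ge> 0\<close> the integrand is the probability that \<open>n\<close> further independent variables exceed \<open>y\<close>.
  The value is therefore the probability that a given one out of \<open>n + 1\<close> variables is the least.
\<close>

lemma nn_integral_exponential_power:
  assumes l: "0 < l"
  shows "(\<integral>\<^sup>+y. ennreal (exp (- l * y)) ^ n \<partial>exponential_measure l) = ennreal (1 / real (Suc n))"
proof -
  let ?m = "real (Suc n)"
  have "(\<integral>\<^sup>+y. ennreal (exp (- l * y)) ^ n \<partial>exponential_measure l) =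
      (\<integral>\<^sup>+y. ennreal (1 / ?m) * ennreal (exponential_density (?m * l) y) \<partial>lborel)"
    unfolding exponential_measure_def
  proof (subst nn_integral_density, simp, simp, rule nn_integral_cong)
    fix y
    \<comment> \<open>Up to the factor \<open>1 / (n + 1)\<close> this is the density of the minimum of \<open>n + 1\<close> variables.\<close>
    have "exponential_density l y * exp (- l * y) ^ n = 1 / ?m * exponential_density (?m * l) y"
      by (simp add: exponential_density_def exp_of_nat_mult [symmetric] exp_add [symmetric] field_simps)
    moreover have "0 \<le> exponential_density l y" "0 \<le> exponential_density (?m * l) y"
      using l by (simp_all add: exponential_density_nonneg)
    ultimately show "ennreal (exponential_density l y) * ennreal (exp (- l * y)) ^ n =
        ennreal (1 / ?m) * ennreal (exponential_density (?m * l) y)"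
      by (simp add: ennreal_mult [symmetric] ennreal_power)
  qed
  also have "\<dots> = ennreal (1 / ?m) * (\<integral>\<^sup>+y. ennreal (exponential_density (?m * l) y) \<partial>lborel)"
    by (rule nn_integral_cmult) simp
  also have "(\<integral>\<^sup>+y. ennreal (exponential_density (?m * l) y) \<partial>lborel) = 1"
    using prob_space.emeasure_space_1[OF prob_space_exponential_density[of "?m * l"]] l
    by (simp add: emeasure_density)
  finally show ?thesis by simp
qed

text \<open>
  Conditionally on \<open>x i = y\<close> being the minimum, the distances from \<open>x i\<close> to the others are
  independent exponential variables, whatever \<open>y\<close> is. Integrating over \<open>y\<close> leaves the probability
  that \<open>x i\<close> is the minimum, which is the factor in front.
\<close>

lemma nn_integral_beyond_minimum:
  fixes h :: "('i \<Rightarrow> real) \<Rightarrow> ennreal"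
  assumes l: "0 < l" and J: "finite J" "i \<notin> J"
    and [measurable]: "h \<in> borel_measurable (PiM J (\<lambda>_. borel))"
  shows "(\<integral>\<^sup>+x. (if \<forall>j\<in>J. x i < x j then h (\<lambda>j\<in>J. x j - x i) else 0)
        \<partial>PiM (insert i J) (\<lambda>_. exponential_measure l)) =
    ennreal (1 / real (Suc (card J))) * (\<integral>\<^sup>+x. h x \<partial>PiM J (\<lambda>_. exponential_measure l))"
proof -
  interpret product_prob_space "\<lambda>_ :: 'i. exponential_measure l"
    using l by (rule product_prob_space_exponential)
  let ?E = "exponential_measure l"
  note [simp] = \<open>finite J\<close>
  let ?H = "\<integral>\<^sup>+x. h x \<partial>PiM J (\<lambda>_. ?E)"
  have "(\<integral>\<^sup>+x. (if \<forall>j\<in>J. x i < x j then h (\<lambda>j\<in>J. x j - x i) else 0) \<partial>PiM (insert i J) (\<lambda>_. ?E)) =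
      (\<integral>\<^sup>+y. (\<integral>\<^sup>+x. (if \<forall>j\<in>J. (x(i := y)) i < (x(i := y)) j then h (\<lambda>j\<in>J. (x(i := y)) j - (x(i := y)) i) else 0)
        \<partial>PiM J (\<lambda>_. ?E)) \<partial>?E)"
    using J by (intro product_nn_integral_insert_rev) auto
  also have "\<dots> = (\<integral>\<^sup>+y. (\<integral>\<^sup>+x. (if \<forall>j\<in>J. y < x j then h (\<lambda>j\<in>J. x j - y) else 0) \<partial>PiM J (\<lambda>_. ?E)) \<partial>?E)"
    using J by (intro nn_integral_cong if_cong arg_cong[where f = h]) (auto simp: fun_eq_iff)
  also have "\<dots> = (\<integral>\<^sup>+y. ennreal (exp (- l * y)) ^ card J * ?H \<partial>?E)"
    by (rule nn_integral_cong_AE, rule eventually_mono[OF AE_exponential_measure_nonneg])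
      (rule nn_integral_PiM_exponential_shift[OF _ l J(1) assms(4)])
  also have "\<dots> = (\<integral>\<^sup>+y. ennreal (exp (- l * y)) ^ card J \<partial>?E) * ?H"
    by (rule nn_integral_multc) measurable
  finally show ?thesis by (simp only: nn_integral_exponential_power[OF l])
qed

text \<open>
  The minimum is attained at a unique index almost surely: the events that \<open>x i\<close> is the strict
  minimum are disjoint, and as each of them has probability \<open>1 / card I\<close>, their union has
  probability \<open>1\<close>.
\<close>

lemma nn_integral_split_minimum:
  fixes g :: "('i \<Rightarrow> real) \<Rightarrow> ennreal"
  assumes l: "0 < l" and I: "finite I" "I \<noteq> {}"
    and [measurable]: "g \<in> borel_measurable (PiM I (\<lambda>_. borel))"
  shows "(\<integral>\<^sup>+x. g x \<partial>PiM I (\<lambda>_. exponential_measure l)) =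
    (\<Sum>i\<in>I. \<integral>\<^sup>+x. (if \<forall>j\<in>I - {i}. x i < x j then g x else 0) \<partial>PiM I (\<lambda>_. exponential_measure l))"
proof -
  let ?P = "PiM I (\<lambda>_. exponential_measure l)"
  interpret P: prob_space ?P by (rule prob_space_PiM) (rule prob_space_exponential_measure[OF l])
  note [simp] = \<open>finite I\<close>
  define A where "A i = {x \<in> space ?P. \<forall>j\<in>I - {i}. x i < x j}" for i
  have A [measurable]: "A i \<in> sets ?P" if "i \<in> I" for i
    unfolding A_def using that by measurable
  have PA: "emeasure ?P (A i) = ennreal (1 / real (card I))" if i: "i \<in> I" for i
  proof -
    have I': "insert i (I - {i}) = I" using i by auto
    have card: "Suc (card (I - {i})) = card I" by (rule card.remove[OF I(1) i, symmetric])
    have "emeasure ?P (A i) = (\<integral>\<^sup>+x. indicator (A i) x \<partial>?P)"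
      using i by simp
    also have "\<dots> = (\<integral>\<^sup>+x. (if \<forall>j\<in>I - {i}. x i < x j then 1 else 0) \<partial>?P)"
      by (intro nn_integral_cong) (auto simp: A_def indicator_def)
    also have "\<dots> = ennreal (1 / real (card I))"
      using nn_integral_beyond_minimum[OF l, of "I - {i}" i "\<lambda>_. 1"]
        P.emeasure_space_1 prob_space.emeasure_space_1[OF prob_space_PiM[OF prob_space_exponential_measure[OF l]], of "I - {i}"]
      unfolding I' card by simp
    finally show ?thesis .
  qed
  have disj: "disjoint_family_on A I"
    unfolding disjoint_family_on_def
  proof (intro ballI impI)
    fix i k assume ik: "i \<in> I" "k \<in> I" "i \<noteq> k"
    have "\<not> (x \<in> A i \<and> x \<in> A k)" for x
    proof
      assume "x \<in> A i \<and> x \<in> A k"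
      then have "x i < x k" "x k < x i" using ik by (auto simp: A_def)
      then show False by simp
    qed
    then show "A i \<inter> A k = {}" by blast
  qed
  have "emeasure ?P (\<Union>i\<in>I. A i) = (\<Sum>i\<in>I. emeasure ?P (A i))"
    using A disj by (intro sum_emeasure [symmetric]) auto
  also have "\<dots> = 1"
    using I by (simp add: PA ennreal_of_nat_eq_real_of_nat ennreal_mult [symmetric])
  finally have "AE x in ?P. x \<in> (\<Union>i\<in>I. A i)"
    using A by (intro P.AE_prob_1) (simp add: measure_def)
  then have "AE x in ?P. g x = (\<Sum>i\<in>I. if \<forall>j\<in>I - {i}. x i < x j then g x else 0)"
  proof eventually_elim
    fix x assume "x \<in> (\<Union>i\<in>I. A i)"
    then obtain i where i: "i \<in> I" "\<forall>j\<in>I - {i}. x i < x j" by (auto simp: A_def)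
    have uniq: "(\<forall>j\<in>I - {k}. x k < x j) \<longleftrightarrow> k = i" if "k \<in> I" for k
      using i that by (metis DiffI less_asym singletonD)
    have "(\<Sum>k\<in>I. if \<forall>j\<in>I - {k}. x k < x j then g x else 0) = (\<Sum>k\<in>I. if k = i then g x else 0)"
      by (intro sum.cong refl if_cong uniq)
    then show "g x = (\<Sum>i\<in>I. if \<forall>j\<in>I - {i}. x i < x j then g x else 0)"
      using i by simp
  qed
  then have "(\<integral>\<^sup>+x. g x \<partial>?P) = (\<integral>\<^sup>+x. (\<Sum>i\<in>I. if \<forall>j\<in>I - {i}. x i < x j then g x else 0) \<partial>?P)"
    by (rule nn_integral_cong_AE)
  also have "\<dots> = (\<Sum>i\<in>I. \<integral>\<^sup>+x. (if \<forall>j\<in>I - {i}. x i < x j then g x else 0) \<partial>?P)"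
    by (rule nn_integral_sum) measurable
  finally show ?thesis .
qed

section \<open>A recursion for the number of clusters, and its limit\<close>

text \<open>
  For \<open>0 \<le> q \<le> 1\<close>, the probability mass function of a sum of \<open>n\<close> independent Bernoulli variables
  with parameters \<open>q ^ 0, \<dots>, q ^ (n - 1)\<close>. The first of them is always \<open>1\<close>: it counts the cluster of the rightmost
  point, after which there is always a gap.
\<close>

primrec cluster_pmf :: "real \<Rightarrow> nat \<Rightarrow> nat \<Rightarrow> real" where
  "cluster_pmf q 0 k = (if k = 0 then 1 else 0)"
| "cluster_pmf q (Suc n) k =
    (1 - q ^ n) * cluster_pmf q n k + q ^ n * (if k = 0 then 0 else cluster_pmf q n (k - 1))"

lemma cluster_pmf_nonneg:
  assumes "0 \<le> q" "q \<le> 1"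
  shows "0 \<le> cluster_pmf q n k"
  using assms
proof (induction n arbitrary: k)
  case (Suc n)
  then have "q ^ n \<le> 1" by (intro power_le_one)
  then show ?case using Suc by simp
qed simp

text \<open>
  The recursion telescopes: adding a Bernoulli variable moves mass across \<open>K\<close> only from \<open>K\<close> itself.
\<close>

lemma sum_cluster_pmf_Suc:
  "(\<Sum>k\<le>K. cluster_pmf q (Suc n) k) = (\<Sum>k\<le>K. cluster_pmf q n k) - q ^ n * cluster_pmf q n K"
  by (induction K) (simp_all add: algebra_simps)

lemma cluster_pmf_eq_0: "n < k \<Longrightarrow> cluster_pmf q n k = 0"
  by (induction n arbitrary: k) auto

lemma sum_cluster_pmf_eq_1: "n \<le> K \<Longrightarrow> (\<Sum>k\<le>K. cluster_pmf q n k) = 1"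
proof (induction n)
  case 0 show ?case by (simp add: sum.delta)
next
  case (Suc n)
  then show ?case by (simp add: sum_cluster_pmf_Suc cluster_pmf_eq_0 del: cluster_pmf.simps)
qed

lemma sum_cluster_pmf_le_1:
  assumes "0 \<le> q" "q \<le> 1"
  shows "(\<Sum>k\<le>K. cluster_pmf q n k) \<le> 1"
proof (induction n)
  case (Suc n)
  have "0 \<le> q ^ n * cluster_pmf q n K"
    using cluster_pmf_nonneg[OF assms] assms by simp
  with Suc show ?case
    unfolding sum_cluster_pmf_Suc by linarith
qed (simp add: sum.delta)

text \<open>
  Tightness. The sum of the first \<open>K\<close> variables is at most \<open>K\<close>, so to exceed \<open>K\<close> one of the later
  ones must be \<open>1\<close>. The bound is the geometric tail \<open>q ^ K + q ^ (K + 1) + \<dots>\<close>.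
\<close>

lemma sum_cluster_pmf_ge:
  assumes q: "0 \<le> q" "q < 1"
  shows "1 - q ^ K / (1 - q) \<le> (\<Sum>k\<le>K. cluster_pmf q n k)"
proof -
  have le1: "cluster_pmf q m k \<le> 1" for m k
  proof -
    have "cluster_pmf q m k \<le> (\<Sum>k\<le>k. cluster_pmf q m k)"
      using q cluster_pmf_nonneg[of q m] by (intro member_le_sum[of k "{..k}" "cluster_pmf q m"]) simp_all
    also have "\<dots> \<le> 1" using q by (intro sum_cluster_pmf_le_1) auto
    finally show ?thesis .
  qed
  have step: "1 - (q ^ K - q ^ (K + m)) / (1 - q) \<le> (\<Sum>k\<le>K. cluster_pmf q (K + m) k)" for m
  proof (induction m)
    case 0 show ?case by (simp add: sum_cluster_pmf_eq_1)
  next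
    case (Suc m)
    have "q ^ (K + m) * cluster_pmf q (K + m) K \<le> q ^ (K + m)"
      using q le1 by (simp add: mult_left_le)
    moreover have "(q ^ K - q ^ (K + Suc m)) / (1 - q) = (q ^ K - q ^ (K + m)) / (1 - q) + q ^ (K + m)"
      using q by (simp add: field_simps)
    ultimately show ?case
      using Suc unfolding add_Suc_right sum_cluster_pmf_Suc by linarith
  qed
  show ?thesis
  proof (cases "n \<le> K")
    case True
    then show ?thesis using q by (simp add: sum_cluster_pmf_eq_1)
  next
    case False
    then obtain m where n: "n = K + m" using le_Suc_ex nat_le_linear by blast
    have "(q ^ K - q ^ (K + m)) / (1 - q) \<le> q ^ K / (1 - q)"
      using q by (intro divide_right_mono) auto
    then show ?thesis using step[of m] unfolding n by linarith
  qed
qed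

text \<open>
  A pointwise limit of probability mass functions may lose mass at infinity. The bound \<open>e\<close> on the
  tails, uniform in \<open>n\<close>, excludes this.
\<close>

lemma pmf_of_tight_limit:
  fixes a :: "nat \<Rightarrow> nat \<Rightarrow> real" and e :: "nat \<Rightarrow> real"
  assumes nonneg: "\<And>n k. 0 \<le> a n k"
    and lim: "\<And>k. convergent (\<lambda>n. a n k)"
    and le: "\<And>n K. (\<Sum>k\<le>K. a n k) \<le> 1"
    and ge: "\<And>n K. 1 - e K \<le> (\<Sum>k\<le>K. a n k)"
    and e: "e \<longlonglongrightarrow> 0"
  shows "\<exists>p :: nat pmf. \<forall>k. (\<lambda>n. a n k) \<longlonglongrightarrow> pmf p k"
proof -
  define b where "b k = lim (\<lambda>n. a n k)" for k
  have b: "(\<lambda>n. a n k) \<longlonglongrightarrow> b k" for k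
    using lim unfolding b_def by (simp add: convergent_LIMSEQ_iff)
  have b0: "0 \<le> b k" for k
    using b nonneg by (intro LIMSEQ_le_const[OF b]) auto
  have S: "(\<lambda>n. \<Sum>k\<le>K. a n k) \<longlonglongrightarrow> (\<Sum>k\<le>K. b k)" for K
    by (intro tendsto_sum b)
  have "(\<Sum>k\<le>K. b k) \<le> 1" for K
    using le by (intro LIMSEQ_le_const2[OF S]) auto
  moreover have "1 - e K \<le> (\<Sum>k\<le>K. b k)" for K
    using ge by (intro LIMSEQ_le_const[OF S]) auto
  moreover have "(\<lambda>K. 1 - e K) \<longlonglongrightarrow> 1"
    using tendsto_diff[OF tendsto_const[of 1] e] by simp
  ultimately have "(\<lambda>K. \<Sum>k\<le>K. b k) \<longlonglongrightarrow> 1"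
    using tendsto_sandwich[of "\<lambda>K. 1 - e K" "\<lambda>K. \<Sum>k\<le>K. b k" sequentially "\<lambda>_. 1" 1] by simp
  then have "b sums 1" unfolding sums_def_le .
  then have "(\<Sum>k. ennreal (b k)) = ennreal 1"
    using b0 by (intro suminf_ennreal_eq)
  then have "(\<integral>\<^sup>+k. ennreal (b k) \<partial>count_space UNIV) = 1"
    by (subst nn_integral_count_space_nat) simp
  then have "pmf (embed_pmf b) k = b k" for k
    using b0 by (intro pmf_embed_pmf) auto
  then show ?thesis using b by (intro exI[of _ "embed_pmf b"]) simp
qed

lemma cluster_pmf_tendsto:
  assumes q: "0 \<le> q" "q < 1"
  shows "\<exists>p :: nat pmf. \<forall>k. (\<lambda>n. cluster_pmf q n k) \<longlonglongrightarrow> pmf p k"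
proof (rule pmf_of_tight_limit)
  show nonneg: "0 \<le> cluster_pmf q n k" for n k
    using q by (intro cluster_pmf_nonneg) auto
  show le: "(\<Sum>k\<le>K. cluster_pmf q n k) \<le> 1" for n K
    using q by (intro sum_cluster_pmf_le_1) auto
  show "1 - q ^ K / (1 - q) \<le> (\<Sum>k\<le>K. cluster_pmf q n k)" for n K
    using q by (rule sum_cluster_pmf_ge)
  have "(\<lambda>K. q ^ K / (1 - q)) \<longlonglongrightarrow> 0 / (1 - q)"
    using q by (intro tendsto_intros LIMSEQ_power_zero) auto
  then show "(\<lambda>K. q ^ K / (1 - q)) \<longlonglongrightarrow> 0" by simp
  have cdf: "convergent (\<lambda>n. \<Sum>k\<le>K. cluster_pmf q n k)" for K
  proof (rule Bseq_monoseq_convergent)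
    show "monoseq (\<lambda>n. \<Sum>k\<le>K. cluster_pmf q n k)"
      using q nonneg
      by (intro decseq_imp_monoseq decseq_SucI)
         (simp add: sum_cluster_pmf_Suc del: cluster_pmf.simps)
    show "Bseq (\<lambda>n. \<Sum>k\<le>K. cluster_pmf q n k)"
      using le nonneg by (intro BseqI'[of _ 1]) (simp add: sum_nonneg)
  qed
  show "convergent (\<lambda>n. cluster_pmf q n k)" for k
  proof (cases k)
    case 0
    then show ?thesis using cdf[of 0] by simp
  next
    case (Suc K)
    then have "(\<lambda>n. cluster_pmf q n k) = (\<lambda>n. (\<Sum>k\<le>Suc K. cluster_pmf q n k) - (\<Sum>k\<le>K. cluster_pmf q n k))"
      by simp
    then show ?thesis using convergent_diff[OF cdf cdf, of "Suc K" K] by (simp only:)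
  qed
qed

section \<open>The law of the number of clusters\<close>

text \<open>
  The induction runs over all index sets of a given size at once. The step removes the index of the
  minimum, which can be any index, and so it calls for the law on each set \<open>I - {i}\<close>.
\<close>

lemma nn_integral_indicator_num_clusters:
  assumes l: "0 < l" and r: "0 \<le> r" and "finite I"
  shows "(\<integral>\<^sup>+x. indicator {k} (num_clusters r I x) \<partial>PiM I (\<lambda>_. exponential_measure l)) =
    ennreal (cluster_pmf (exp (- l * r)) (card I) k)"
  using assms(3)
proof (induction "card I" arbitrary: I k)
  case 0
  then have "I = {}" by simp
  then show ?case
    by (simp add: PiM_empty nn_integral_count_space_finite num_clusters_def)
next
  case (Suc n)
  let ?E = "exponential_measure l"
  let ?q = "exp (- l * r)"
  let ?a = "cluster_pmf ?q n"
  have I: "finite I" "I \<noteq> {}" using Suc by auto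
  have q: "0 \<le> ?q" "?q \<le> 1" using l r by auto
  have qn: "0 \<le> ?q ^ n" "?q ^ n \<le> 1" using q by (auto intro: power_le_one)
  note [measurable] = borel_measurable_num_clusters[OF I(1), of "indicator {k}"]
  have part: "(\<integral>\<^sup>+x. (if \<forall>j\<in>I - {i}. x i < x j then indicator {k} (num_clusters r I x) else 0) \<partial>PiM I (\<lambda>_. ?E)) =
      ennreal (1 / real (Suc n)) * ennreal (cluster_pmf ?q (Suc n) k)" if i: "i \<in> I" for i
  proof -
    define J where "J = I - {i}"
    have J: "finite J" "i \<notin> J" "insert i J = I" "card J = n"
      using i I Suc(2) by (auto simp: J_def card_Diff_singleton)
    have [measurable]: "(\<lambda>z. indicator {m} (num_clusters r J z) :: ennreal) \<in> borel_measurable (PiM J (\<lambda>_. borel))"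
      "(\<lambda>z. indicator {m} (Suc (num_clusters r J z)) :: ennreal) \<in> borel_measurable (PiM J (\<lambda>_. borel))" for m
      using borel_measurable_num_clusters[OF J(1), of "indicator {m}"]
        borel_measurable_num_clusters[OF J(1), of "\<lambda>c. indicator {m} (Suc c)"] by simp_all
    note [simp] = J(1)
    \<comment> \<open>The event of interest in terms of the distances \<open>z\<close> to the minimum \<open>x i\<close>.\<close>
    define h :: "(nat \<Rightarrow> real) \<Rightarrow> ennreal" where
      "h z = indicator {k} (num_clusters r J z + of_bool (\<forall>j\<in>J. r < z j))" for z
    have hm [measurable]: "h \<in> borel_measurable (PiM J (\<lambda>_. borel))"
    proof -
      have eq: "h = (\<lambda>z. if \<forall>j\<in>J. r < z j then indicator {k} (Suc (num_clusters r J z)) else indicator {k} (num_clusters r J z))"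
        by (auto simp: h_def fun_eq_iff)
      show ?thesis unfolding eq by measurable
    qed
    have law: "(\<integral>\<^sup>+z. indicator {m} (num_clusters r J z) \<partial>PiM J (\<lambda>_. ?E)) = ennreal (?a m)" for m
      using Suc(1)[of J m] J by simp
    \<comment> \<open>The first gap and the clusters behind it are independent: shortening a long first gap by \<open>r\<close>
      keeps these clusters.\<close>
    have far: "(\<integral>\<^sup>+z. (if \<forall>j\<in>J. r < z j then indicator {m} (num_clusters r J z) else 0) \<partial>PiM J (\<lambda>_. ?E)) =
        ennreal (?q ^ n * ?a m)" for m
    proof -
      have "num_clusters r J (\<lambda>j\<in>J. z j - r) = num_clusters r J z" for z
        by (rule num_clusters_translate[where c = "- r"]) simp
      then have "(\<integral>\<^sup>+z. (if \<forall>j\<in>J. r < z j then indicator {m} (num_clusters r J z) else 0) \<partial>PiM J (\<lambda>_. ?E)) =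
        ennreal ?q ^ card J * (\<integral>\<^sup>+z. indicator {m} (num_clusters r J z) \<partial>PiM J (\<lambda>_. ?E))"
        using nn_integral_PiM_exponential_shift[OF r l J(1), of "\<lambda>z. indicator {m} (num_clusters r J z)"]
        by (simp cong del: if_weak_cong)
      then show ?thesis
        using qn cluster_pmf_nonneg[OF q] by (simp add: law J(4) ennreal_power ennreal_mult)
    qed
    have H: "(\<integral>\<^sup>+z. h z \<partial>PiM J (\<lambda>_. ?E)) = ennreal (cluster_pmf ?q (Suc n) k)"
    proof -
      let ?c = "if k = 0 then 0 else ?a (k - 1)"
      let ?F = "\<lambda>m z. if \<forall>j\<in>J. r < z j then indicator {m} (num_clusters r J z) else (0 :: ennreal)"
      \<comment> \<open>Adding the mass that the first gap moves away from \<open>k\<close> avoids subtraction in \<open>ennreal\<close>.\<close>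
      have "(\<integral>\<^sup>+z. h z \<partial>PiM J (\<lambda>_. ?E)) + ennreal (?q ^ n * ?a k) =
          (\<integral>\<^sup>+z. h z + ?F k z \<partial>PiM J (\<lambda>_. ?E))"
        by (subst nn_integral_add) (simp_all add: far)
      also have "\<dots> = (\<integral>\<^sup>+z. indicator {k} (num_clusters r J z) + (if k = 0 then 0 else ?F (k - 1) z) \<partial>PiM J (\<lambda>_. ?E))"
        by (intro nn_integral_cong) (auto simp: h_def indicator_def)
      also have "\<dots> = ennreal (?a k) + ennreal (?q ^ n * ?c)"
        by (subst nn_integral_add) (simp_all add: law far)
      also have "\<dots> = ennreal (cluster_pmf ?q (Suc n) k) + ennreal (?q ^ n * ?a k)"
      proof -
        have "ennreal (?a k) + ennreal (?q ^ n * ?c) = ennreal (?a k + ?q ^ n * ?c)"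
          using qn cluster_pmf_nonneg[OF q] by (intro ennreal_plus [symmetric]) auto
        also have "?a k + ?q ^ n * ?c = cluster_pmf ?q (Suc n) k + ?q ^ n * ?a k"
          by (simp add: algebra_simps)
        also have "ennreal \<dots> = ennreal (cluster_pmf ?q (Suc n) k) + ennreal (?q ^ n * ?a k)"
          using qn cluster_pmf_nonneg[OF q] by (intro ennreal_plus mult_nonneg_nonneg)
        finally show ?thesis .
      qed
      finally show ?thesis by (simp only: ennreal_add_left_cancel add.commute[of _ "ennreal (?q ^ n * ?a k)"]) simp
    qed
    have "(\<integral>\<^sup>+x. (if \<forall>j\<in>I - {i}. x i < x j then indicator {k} (num_clusters r I x) else 0) \<partial>PiM I (\<lambda>_. ?E)) =
        (\<integral>\<^sup>+x. (if \<forall>j\<in>J. x i < x j then h (\<lambda>j\<in>J. x j - x i) else 0) \<partial>PiM (insert i J) (\<lambda>_. ?E))"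
      unfolding J(3) J_def[symmetric]
    proof (intro nn_integral_cong if_cong refl)
      fix x :: "nat \<Rightarrow> real" assume min: "\<forall>j\<in>J. x i < x j"
      have "num_clusters r I x = num_clusters r J x + of_bool (\<forall>j\<in>J. x i + r < x j)"
        using num_clusters_insert_minimum[OF J(1,2), of x r] min J(3) by simp
      also have "num_clusters r J x = num_clusters r J (\<lambda>j\<in>J. x j - x i)"
        by (rule num_clusters_translate[where c = "x i"]) simp
      also have "(\<forall>j\<in>J. x i + r < x j) \<longleftrightarrow> (\<forall>j\<in>J. r < (\<lambda>j\<in>J. x j - x i) j)"
        by (auto simp: algebra_simps)
      finally show "indicator {k} (num_clusters r I x) = h (\<lambda>j\<in>J. x j - x i)"
        by (simp only: h_def)
    qed
    also have "\<dots> = ennreal (1 / real (Suc n)) * ennreal (cluster_pmf ?q (Suc n) k)"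
      using nn_integral_beyond_minimum[OF l J(1,2) hm] J(4) H by simp
    finally show ?thesis .
  qed
  have "(\<integral>\<^sup>+x. indicator {k} (num_clusters r I x) \<partial>PiM I (\<lambda>_. ?E)) =
      (\<Sum>i\<in>I. ennreal (1 / real (Suc n)) * ennreal (cluster_pmf ?q (Suc n) k))"
    by (subst nn_integral_split_minimum[OF l I]) (simp_all add: part cong: sum.cong)
  also have "\<dots> = of_nat (Suc n) * ennreal (1 / real (Suc n)) * ennreal (cluster_pmf ?q (Suc n) k)"
    using Suc(2) by (simp add: mult.assoc)
  also have "of_nat (Suc n) * ennreal (1 / real (Suc n)) = 1"
    by (simp add: ennreal_of_nat_eq_real_of_nat ennreal_mult [symmetric] del: of_nat_Suc)
  finally show ?case using Suc(2) by simp
qed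

text \<open>
  The joint law of independent variables is the product measure, to which the preceding lemma
  applies.
\<close>

lemma prob_num_clusters:
  assumes "prob_space M" and l: "0 < l" and r: "0 \<le> r" and I: "finite I" "I \<noteq> {}"
    and indep: "prob_space.indep_vars M (\<lambda>_. borel) X I"
    and expo: "\<And>i. i \<in> I \<Longrightarrow> distributed M lborel (X i) (exponential_density l)"
  shows "(\<lambda>\<omega>. num_clusters r I (\<lambda>i. X i \<omega>)) \<in> measurable M (count_space UNIV)"
    and "measure M {\<omega> \<in> space M. num_clusters r I (\<lambda>i. X i \<omega>) = k} = cluster_pmf (exp (- l * r)) (card I) k"
proof -
  interpret prob_space M by fact
  let ?X = "\<lambda>\<omega>. \<lambda>i\<in>I. X i \<omega>"
  have X [measurable]: "X i \<in> borel_measurable M" if "i \<in> I" for i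
    using expo[OF that] by (simp add: distributed_def)
  have Xm [measurable]: "?X \<in> measurable M (PiM I (\<lambda>_. borel))"
    by (intro measurable_restrict X)
  have [measurable]: "(\<lambda>x. indicator {k} (num_clusters r I x) :: ennreal) \<in> borel_measurable (PiM I (\<lambda>_. borel))"
    by (rule borel_measurable_num_clusters[OF I(1)])
  have restr: "num_clusters r I (?X \<omega>) = num_clusters r I (\<lambda>i. X i \<omega>)" for \<omega>
    by (rule num_clusters_translate[where c = 0]) simp
  show meas [measurable]: "(\<lambda>\<omega>. num_clusters r I (\<lambda>i. X i \<omega>)) \<in> measurable M (count_space UNIV)"
    using measurable_compose[OF Xm measurable_num_clusters[OF I(1), of r]] unfolding restr .
  have "distr M (PiM I (\<lambda>_. borel)) ?X = PiM I (\<lambda>i. distr M borel (X i))"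
    using indep indep_vars_iff_distr_eq_PiM'[OF I(2), where M' = "\<lambda>_. borel" and X = X] X by simp
  also have "\<dots> = PiM I (\<lambda>_. exponential_measure l)"
  proof (rule PiM_cong[OF refl])
    fix i assume "i \<in> I"
    then have "distr M lborel (X i) = exponential_measure l"
      using expo by (simp add: distributed_def exponential_measure_def)
    then show "distr M borel (X i) = exponential_measure l"
      by (simp cong: distr_cong)
  qed
  finally have D: "distr M (PiM I (\<lambda>_. borel)) ?X = PiM I (\<lambda>_. exponential_measure l)" .
  have "emeasure M {\<omega> \<in> space M. num_clusters r I (\<lambda>i. X i \<omega>) = k} =
      (\<integral>\<^sup>+\<omega>. indicator {\<omega> \<in> space M. num_clusters r I (\<lambda>i. X i \<omega>) = k} \<omega> \<partial>M)"
    by (rule nn_integral_indicator [symmetric]) measurable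
  also have "\<dots> = (\<integral>\<^sup>+\<omega>. indicator {k} (num_clusters r I (?X \<omega>)) \<partial>M)"
    unfolding restr by (intro nn_integral_cong) (auto simp: indicator_def)
  also have "\<dots> = (\<integral>\<^sup>+x. indicator {k} (num_clusters r I x) \<partial>distr M (PiM I (\<lambda>_. borel)) ?X)"
    by (subst nn_integral_distr) simp_all
  also have "\<dots> = ennreal (cluster_pmf (exp (- l * r)) (card I) k)"
    unfolding D by (rule nn_integral_indicator_num_clusters[OF l r I(1)])
  finally show "measure M {\<omega> \<in> space M. num_clusters r I (\<lambda>i. X i \<omega>) = k} = cluster_pmf (exp (- l * r)) (card I) k"
    using l r by (simp add: measure_def cluster_pmf_nonneg)
qed

section \<open>Convergence in distribution\<close>

lemma weak_conv_m_of_pmf_tendsto: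
  fixes N :: "nat \<Rightarrow> 'a \<Rightarrow> nat"
  assumes prob: "\<And>n. prob_space (M n)"
    and meas: "\<And>n. N n \<in> measurable (M n) (count_space UNIV)"
    and lim: "\<And>k. (\<lambda>n. measure (M n) {\<omega> \<in> space (M n). N n \<omega> = k}) \<longlonglongrightarrow> pmf p k"
  shows "weak_conv_m (\<lambda>n. distr (M n) borel (\<lambda>\<omega>. real (N n \<omega>))) (distr (measure_pmf p) borel real)"
  unfolding weak_conv_m_def weak_conv_def
proof (intro allI impI)
  fix x :: real
  define K where "K = {k. real k \<le> x}"
  have "K \<subseteq> {..nat \<lfloor>x\<rfloor>}" by (auto simp: K_def le_nat_floor)
  then have fin: "finite K" by (rule finite_subset) simp
  have "cdf (distr (M n) borel (\<lambda>\<omega>. real (N n \<omega>))) x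
      = (\<Sum>k\<in>K. measure (M n) {\<omega> \<in> space (M n). N n \<omega> = k})" for n
  proof -
    interpret prob_space "M n" by (rule prob)
    note [measurable] = meas[of n]
    have "cdf (distr (M n) borel (\<lambda>\<omega>. real (N n \<omega>))) x = measure (M n) (\<Union>k\<in>K. {\<omega> \<in> space (M n). N n \<omega> = k})"
      unfolding cdf_def by (subst measure_distr) (auto simp: K_def intro!: arg_cong[where f = "measure (M n)"])
    also have "\<dots> = (\<Sum>k\<in>K. measure (M n) {\<omega> \<in> space (M n). N n \<omega> = k})"
      by (rule finite_measure_finite_Union[OF fin]) (auto simp: disjoint_family_on_def)
    finally show ?thesis .
  qed
  moreover have "cdf (distr (measure_pmf p) borel real) x = (\<Sum>k\<in>K. pmf p k)"
  proof -
    have "cdf (distr (measure_pmf p) borel real) x = measure (measure_pmf p) K"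
      unfolding cdf_def by (subst measure_distr) (auto simp: K_def intro!: arg_cong[where f = "measure (measure_pmf p)"])
    then show ?thesis using fin by (simp add: measure_measure_pmf_finite)
  qed
  ultimately show "(\<lambda>n. cdf (distr (M n) borel (\<lambda>\<omega>. real (N n \<omega>))) x) \<longlonglongrightarrow> cdf (distr (measure_pmf p) borel real) x"
    by (simp add: tendsto_sum lim)
qed

theorem theorem2:
  fixes M :: "nat \<Rightarrow> 'a measure"
    and X :: "nat \<Rightarrow> nat \<Rightarrow> 'a \<Rightarrow> real"
    and rate r :: real
    and N :: "nat \<Rightarrow> 'a \<Rightarrow> nat"
  assumes rate: "rate > 0"
    and r: "r > 0"
    and prob: "\<And>n. prob_space (M n)"
    and indep: "\<And>n. prob_space.indep_vars (M n) (\<lambda>_. borel) (X n) {1..n}"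
    and expo: "\<And>n i. i \<in> {1..n} \<Longrightarrow> distributed (M n) lborel (X n i) (exponential_density rate)"
  defines "N \<equiv> \<lambda>n \<omega>. num_components (with_proj (geometric_graph n r (\<lambda>i. X n i \<omega>)))"
  shows "\<exists>p :: nat pmf.
      (\<forall>k. (\<lambda>n. measure (M n) {\<omega> \<in> space (M n). N n \<omega> = k}) \<longlonglongrightarrow> pmf p k) \<and>
      weak_conv_m (\<lambda>n. distr (M n) borel (\<lambda>\<omega>. real (N n \<omega>))) (distr (measure_pmf p) borel real)"
proof -
  have N: "N n = (\<lambda>\<omega>. num_clusters r {1..n} (\<lambda>i. X n i \<omega>))" for n
    using r by (simp add: N_def num_components_geometric_graph)
  have r0: "0 \<le> r" using r by simp
  have law: "N n \<in> measurable (M n) (count_space UNIV) \<and>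
      measure (M n) {\<omega> \<in> space (M n). N n \<omega> = k} = cluster_pmf (exp (- rate * r)) n k"
    if "n > 0" for n k
    using prob_num_clusters[OF prob[of n] rate r0 _ _ indep[of n] expo[of _ n]] that unfolding N by simp
  obtain p :: "nat pmf" where p: "\<And>k. (\<lambda>n. cluster_pmf (exp (- rate * r)) n k) \<longlonglongrightarrow> pmf p k"
    using cluster_pmf_tendsto[of "exp (- rate * r)"] rate r by auto
  have lim: "(\<lambda>n. measure (M n) {\<omega> \<in> space (M n). N n \<omega> = k}) \<longlonglongrightarrow> pmf p k" for k
    using p[of k] law by (elim Lim_transform_eventually) (auto intro: eventually_sequentiallyI[of 1])
  have "N 0 = (\<lambda>\<omega>. 0)" by (simp add: N num_clusters_def)
  then have "N n \<in> measurable (M n) (count_space UNIV)" for n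
    using law by (cases "n = 0") auto
  then show ?thesis
    using lim weak_conv_m_of_pmf_tendsto[OF prob _ lim] by blast
qed

end
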